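(* Let $d_1=d_1(n)$ and $d_2=d_2(n)$ be nonnegative integers with $d_1+d_2\le n-1$, with $nd_1$, $nd_2$ even, and with $d_1+d_2\to\infty$ as $n\to\infty$. Let $\boldsymbol{G}_{d_1+d_2}\sim\mathcal{G}(n,d_1+d_2)$. Then the following two statements are equivalent: (1) there is a coupling $(\boldsymbol{G}_{\oplus},\boldsymbol{G}'_{d_1+d_2})$ such that $\boldsymbol{G}_{\oplus}\sim\mathcal{G}(n,d_1)\oplus\mathcal{G}(n,d_2)$, $\boldsymbol{G}'_{d_1+d_2}\sim\mathcal{G}(n,d_1+d_2)$ and $\mathbb{P}(\boldsymbol{G}_{\oplus}=\boldsymbol{G}'_{d_1+d_2})=1-o(1)$; (2) for any fixed $\varepsilon>0$, $$\mathbb{P}\Big(|\mathcal{R}_{d_1}(\boldsymbol{G}_{d_1+d_2})|\le(1-\varepsilon)\,\mathbb{E}|\mathcal{R}_{d_1}(\boldsymbol{G}_{d_1+d_2})|\Big)\to0.$$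
   Context: All asymptotics are as $n\to\infty$ (along those $n$ for which $nd_1$ and $nd_2$ are even). Graphs are simple and labelled; $[n]=\{1,\dots,n\}$. $\mathcal{G}(n,d)$ denotes the uniform distribution on the set of labelled $d$-regular graphs with vertex set $[n]$. $\mathcal{G}(n,d_1)\oplus\mathcal{G}(n,d_2)$ denotes the distribution of the union of independent random graphs $\boldsymbol{G}_{d_1}\sim\mathcal{G}(n,d_1)$ and $\boldsymbol{G}_{d_2}\sim\mathcal{G}(n,d_2)$ conditioned on the event that they are edge-disjoint. For a graph $G$ and a nonnegative integer $h$, $\mathcal{R}_h(G)$ denotes the set of $h$-regular spanning subgraphs of $G$. A coupling of random variables with prescribed distributions is a joint distribution with those marginals. *)

theory Defs
  imports "HOL-Probability.Probability" "HOL-Library.Ramsey"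
begin

text \<open>A simple labelled graph with vertex set \<open>{1..n}\<close> is identified with its edge set,
  a set of two-element subsets of \<open>{1..n}\<close>; the vertex set is carried by the parameter \<open>n\<close>.\<close>

type_synonym graph = "nat set set"

definition degree :: "graph \<Rightarrow> nat \<Rightarrow> nat" where
  "degree G v = card {e \<in> G. v \<in> e}"

definition regular_graphs :: "nat \<Rightarrow> nat \<Rightarrow> graph set" where
  "regular_graphs n d = {G. G \<subseteq> nsets {1..n} 2 \<and> (\<forall>v\<in>{1..n}. degree G v = d)}"

definition spanning_regular_subgraphs :: "nat \<Rightarrow> nat \<Rightarrow> graph \<Rightarrow> graph set" where
  "spanning_regular_subgraphs n h G = {H \<in> regular_graphs n h. H \<subseteq> G}"

text \<open>\<^const>\<open>pmf_of_set\<close> and \<^const>\<open>cond_pmf\<close> are only meaningful on nonempty sets and on events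
  meeting the support. Both requirements hold below when \<open>d\<close>, respectively \<open>d1 + d2\<close>, is less
  than \<open>n\<close> and \<open>n * d\<close>, respectively both \<open>n * d1\<close> and \<open>n * d2\<close>, are even.\<close>

definition random_regular :: "nat \<Rightarrow> nat \<Rightarrow> graph pmf" where
  "random_regular n d = pmf_of_set (regular_graphs n d)"

definition random_regular_sum :: "nat \<Rightarrow> nat \<Rightarrow> nat \<Rightarrow> graph pmf" where
  "random_regular_sum n d1 d2 =
     map_pmf (\<lambda>(G, H). G \<union> H)
       (cond_pmf (pair_pmf (random_regular n d1) (random_regular n d2)) {(G, H). G \<inter> H = {}})"

definition is_coupling :: "('a \<times> 'b) pmf \<Rightarrow> 'a pmf \<Rightarrow> 'b pmf \<Rightarrow> bool" where
  "is_coupling C p q \<longleftrightarrow> map_pmf fst C = p \<and> map_pmf snd C = q"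

definition admissible :: "(nat \<Rightarrow> nat) \<Rightarrow> (nat \<Rightarrow> nat) \<Rightarrow> nat set" where
  "admissible d1 d2 = {n. n \<ge> 1 \<and> even (n * d1 n) \<and> even (n * d2 n)}"

text \<open>The limit \<open>n \<rightarrow> \<infinity>\<close> along the admissible \<open>n\<close>.\<close>

definition admissible_at_top :: "(nat \<Rightarrow> nat) \<Rightarrow> (nat \<Rightarrow> nat) \<Rightarrow> nat filter" where
  "admissible_at_top d1 d2 = inf at_top (principal (admissible d1 d2))"

end

theory Submission
  imports Defs "HOL-Number_Theory.Cong"
begin

text \<open>
  Write \<open>d = d1 + d2\<close> and let \<open>X G\<close> be the number of spanning \<open>d1\<close>-regular subgraphs of a
  \<open>d\<close>-regular graph \<open>G\<close>. Splitting \<open>G\<close> as an edge-disjoint union of a \<open>d1\<close>-regular and a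
  \<open>d2\<close>-regular graph is the same as choosing such a subgraph, because its complement in \<open>G\<close> is
  automatically \<open>d2\<close>-regular. A uniform edge-disjoint pair therefore has union \<open>G\<close> with probability
  proportional to \<open>X G\<close>: the distribution \<open>p\<close> of the edge-disjoint union is the size-biased version of
  the uniform distribution \<open>q\<close> with respect to \<open>X\<close>, that is, \<open>p G * \<mu> = X G * q G\<close> where \<open>\<mu>\<close> is the
  mean of \<open>X\<close> under \<open>q\<close> (\<open>random_regular_sum_size_biased\<close>).

  For size-biased distributions the equivalence is a general fact. The least possible probability
  that the two coordinates of a coupling of \<open>p\<close> and \<open>q\<close> differ is the total variation distance, here
  the mean of the positive part of \<open>1 - X / \<mu>\<close> under \<open>q\<close>. This is a variable with values in \<open>[0, 1]\<close>,
  so its mean tends to zero iff it tends to zero in probability, and that is the lower tail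
  condition. Quantitatively, for every \<open>\<epsilon> > 0\<close> and with \<open>T\<close> the probability that
  \<open>X \<le> (1 - \<epsilon>) * \<mu>\<close>, every coupling has \<open>\<epsilon> * T\<close> as a lower bound on its probability of disagreement
  (\<open>size_biased_lower_tail_le\<close>), and a maximal coupling (\<open>exists_maximal_coupling\<close>) has \<open>\<epsilon> + T\<close> as
  an upper bound (\<open>maximal_coupling_size_biased_le\<close>).

  Conditioning on edge-disjointness makes sense only if some edge-disjoint pair exists, which is
  \<open>exists_disjoint_regular_graphs\<close>. For even \<open>n\<close> it uses the round-robin decomposition of the complete
  graph into \<open>n - 1\<close> perfect matchings; for odd \<open>n\<close> both degrees are even, and the decomposition
  into \<open>(n - 1) div 2\<close> circulant 2-regular graphs is enough.
\<close>

section \<open>Couplings with a size-biased distribution\<close>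

lemma integral_measure_pmf_count_space:
  fixes f :: "'a \<Rightarrow> real"
  shows "measure_pmf.expectation p f = (\<integral>x. pmf p x * f x \<partial>count_space UNIV)"
  unfolding measure_pmf_eq_density by (subst integral_density) auto

lemma integral_pmf_count_space: "(\<integral>x. pmf p x \<partial>count_space UNIV) = 1"
  using integral_measure_pmf_count_space[of p "\<lambda>_. 1"] by simp

lemma integrable_pmf_excess: "integrable (count_space UNIV) (\<lambda>x. max 0 (pmf q x - pmf p x))"
  by (intro integrable_max Bochner_Integration.integrable_diff integrable_pmf integrable_zero)

text \<open>
  The statement is in product form so that it also covers \<open>f = 0\<close>, where \<open>r\<close> is arbitrary. In the
  construction of a maximal coupling this is the case of equal distributions.
\<close>

lemma ex_pmf_proportional:
  fixes f :: "'a \<Rightarrow> real"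
  assumes int: "integrable (count_space UNIV) f" and nonneg: "\<And>x. 0 \<le> f x"
  shows "\<exists>r. \<forall>x. f x = (\<integral>x. f x \<partial>count_space UNIV) * pmf r x"
proof -
  define t where "t = (\<integral>x. f x \<partial>count_space UNIV)"
  have "t \<ge> 0" unfolding t_def using nonneg by (simp add: integral_nonneg_AE)
  show ?thesis
  proof (cases "t = 0")
    case True
    then have "AE x in count_space UNIV. f x = 0"
      using integral_nonneg_eq_0_iff_AE[OF int] nonneg t_def by simp
    then have "f x = 0" for x by (simp add: AE_count_space)
    then show ?thesis by simp
  next
    case False
    with \<open>t \<ge> 0\<close> have t: "t > 0" by simp
    have "(\<integral>\<^sup>+x. ennreal (f x / t) \<partial>count_space UNIV) = ennreal (\<integral>x. f x / t \<partial>count_space UNIV)"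
      using int nonneg t by (intro nn_integral_eq_integral) auto
    also have "\<dots> = 1" using t by (simp add: t_def)
    finally have "pmf (embed_pmf (\<lambda>x. f x / t)) x = f x / t" for x
      using nonneg t by (intro pmf_embed_pmf) auto
    then show ?thesis using t unfolding t_def[symmetric]
      by (intro exI[of _ "embed_pmf (\<lambda>x. f x / t)"]) simp
  qed
qed

text \<open>
  Draw \<open>x\<close> from \<open>p\<close> and keep it as the second coordinate with probability \<open>min 1 (q x / p x)\<close>; otherwise
  draw the second coordinate from the distribution \<open>r\<close> proportional to the excess of \<open>q\<close> over \<open>p\<close>.
  A value \<open>y\<close> is then kept with probability \<open>min (p y) (q y)\<close>, and redrawing supplies exactly the
  mass of \<open>q\<close> that is still missing. The total excess is the total variation distance.
\<close>

lemma exists_maximal_coupling: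
  fixes p q :: "'a pmf"
  shows "\<exists>C. is_coupling C p q \<and>
    1 - measure_pmf.prob C {(x, y). x = y} \<le> (\<integral>x. max 0 (pmf q x - pmf p x) \<partial>count_space UNIV)"
proof -
  define t where "t = (\<integral>x. max 0 (pmf q x - pmf p x) \<partial>count_space UNIV)"
  obtain r where r: "\<And>x. max 0 (pmf q x - pmf p x) = t * pmf r x"
    using ex_pmf_proportional[OF integrable_pmf_excess, of q p] unfolding t_def by auto
  define k where "k x = (if pmf p x = 0 then 0 else min 1 (pmf q x / pmf p x))" for x
  have k01: "0 \<le> k x" "k x \<le> 1" for x by (auto simp: k_def)
  have kp: "pmf p x * k x = pmf q x - max 0 (pmf q x - pmf p x)" for x
  proof (cases "pmf p x = 0")
    case False
    then have "pmf p x > 0" by (simp add: pmf_pos)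
    then show ?thesis by (auto simp: k_def min_def max_def field_simps)
  qed (simp add: k_def)
  have Ek: "measure_pmf.expectation p k = 1 - t"
    unfolding integral_measure_pmf_count_space kp t_def
    by (subst Bochner_Integration.integral_diff)
       (auto simp: integral_pmf_count_space integrable_pmf integrable_pmf_excess)
  have intk: "integrable (measure_pmf p) k"
    by (rule measure_pmf.integrable_const_bound[where B=1]) (use k01 in auto)
  define C where "C = bind_pmf p (\<lambda>x. bind_pmf (bernoulli_pmf (k x))
                        (\<lambda>b. if b then return_pmf (x, x) else map_pmf (Pair x) r))"
  have "map_pmf fst C = bind_pmf p (\<lambda>x. bind_pmf (bernoulli_pmf (k x)) (\<lambda>b. return_pmf x))"
    unfolding C_def map_bind_pmf
    by (intro bind_pmf_cong refl) (auto simp: pmf.map_comp o_def map_pmf_const)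
  then have fst: "map_pmf fst C = p" by (simp add: bind_return_pmf')
  have snd: "map_pmf snd C = q"
  proof (rule pmf_eqI)
    fix y
    have *: "pmf (bind_pmf (bernoulli_pmf (k x)) (\<lambda>b. if b then return_pmf x else r)) y
        = indicator {y} x * k x + pmf r y * (1 - k x)" for x
      unfolding pmf_bind using k01[of x] by (auto simp: indicator_def)
    have "map_pmf snd C = bind_pmf p (\<lambda>x. bind_pmf (bernoulli_pmf (k x))
            (\<lambda>b. if b then return_pmf x else r))"
      unfolding C_def map_bind_pmf
      by (intro bind_pmf_cong refl) (auto simp: pmf.map_comp o_def)
    then have "pmf (map_pmf snd C) y =
        measure_pmf.expectation p (\<lambda>x. indicator {y} x * k x + pmf r y * (1 - k x))"
      by (simp add: pmf_bind[of p] *)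
    also have "\<dots> = measure_pmf.expectation p (\<lambda>x. indicator {y} x * k x)
        + pmf r y * (1 - measure_pmf.expectation p k)"
    proof -
      have "integrable (measure_pmf p) (\<lambda>x. indicator {y} x * k x)"
        by (rule measure_pmf.integrable_const_bound[where B=1])
           (use k01 in \<open>auto simp: indicator_def\<close>)
      then show ?thesis using intk by simp
    qed
    also have "measure_pmf.expectation p (\<lambda>x. indicator {y} x * k x) = pmf p y * k y"
      by (subst integral_measure_pmf_real[of "{y}"]) (auto simp: indicator_def)
    finally show "pmf (map_pmf snd C) y = pmf q y"
      using kp[of y] r[of y] Ek by (simp add: mult.commute)
  qed
  have "1 - t \<le> measure_pmf.prob C {(x, y). x = y}"
  proof -
    have "map_pmf (\<lambda>(x, y). x = y) C = bind_pmf p (\<lambda>x. bind_pmf (bernoulli_pmf (k x))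
            (\<lambda>b. if b then return_pmf True else map_pmf (\<lambda>y. x = y) r))" (is "_ = bind_pmf p ?f")
      unfolding C_def map_bind_pmf
      by (intro bind_pmf_cong refl) (auto simp: pmf.map_comp o_def)
    then have "pmf (map_pmf (\<lambda>(x, y). x = y) C) True = measure_pmf.expectation p (\<lambda>x. pmf (?f x) True)"
      by (simp only: pmf_bind)
    moreover have "k x \<le> pmf (?f x) True" for x
      unfolding pmf_bind using k01[of x] by auto
    then have "measure_pmf.expectation p k \<le> measure_pmf.expectation p (\<lambda>x. pmf (?f x) True)"
      by (intro integral_mono intk measure_pmf.integrable_const_bound[where B=1])
         (auto simp: pmf_le_1)
    moreover have "pmf (map_pmf (\<lambda>(x, y). x = y) C) True = measure_pmf.prob C {(x, y). x = y}"
      unfolding pmf_map by (intro arg_cong[where f = "measure_pmf.prob C"]) auto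
    ultimately show ?thesis using Ek by linarith
  qed
  then show ?thesis using fst snd unfolding is_coupling_def t_def by (intro exI[of _ C]) auto
qed

lemma prob_coupling_le:
  assumes "is_coupling C p q"
  shows "measure_pmf.prob q A \<le> measure_pmf.prob p A + (1 - measure_pmf.prob C {(x, y). x = y})"
proof -
  have "measure_pmf.prob q A = measure_pmf.prob C (snd -` A)"
    "measure_pmf.prob p A = measure_pmf.prob C (fst -` A)"
    using assms by (auto simp: is_coupling_def)
  moreover have "measure_pmf.prob C (snd -` A) \<le> measure_pmf.prob C (fst -` A \<union> - {(x, y). x = y})"
    by (intro measure_pmf.finite_measure_mono) auto
  moreover have "\<dots> \<le> measure_pmf.prob C (fst -` A) + measure_pmf.prob C (- {(x, y). x = y})"
    by (intro measure_Un_le) auto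
  moreover have "measure_pmf.prob C (- {(x, y). x = y}) = 1 - measure_pmf.prob C {(x, y). x = y}"
    using measure_pmf.prob_compl[of "{(x, y). x = y}" C] by (simp add: Compl_eq_Diff_UNIV)
  ultimately show ?thesis by linarith
qed

lemma prob_count_space:
  "measure_pmf.prob p A = (\<integral>x. pmf p x * indicator A x \<partial>count_space UNIV)"
  using integral_measure_pmf_count_space[of p "indicator A"] by simp

lemma integrable_pmf_indicator:
  "integrable (count_space UNIV) (\<lambda>x. pmf p x * indicator A x :: real)"
  by (intro integrable_real_mult_indicator integrable_pmf) auto

text \<open>
  On the lower tail event the size-biased mass \<open>p\<close> is at most \<open>1 - \<epsilon>\<close> times the mass \<open>q\<close>. Its
  probability under \<open>q\<close> hence exceeds its probability under \<open>p\<close> by at least \<open>\<epsilon>\<close> times the former, and the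
  coordinates of any coupling must disagree at least that often.
\<close>

lemma size_biased_lower_tail_le:
  fixes p q :: "'a pmf" and X :: "'a \<Rightarrow> real"
  assumes bias: "\<And>x. pmf p x * \<mu> = X x * pmf q x" and "\<mu> > 0"
  assumes C: "is_coupling C p q"
  shows "\<epsilon> * measure_pmf.prob q {x. X x \<le> (1 - \<epsilon>) * \<mu>} \<le> 1 - measure_pmf.prob C {(x, y). x = y}"
proof -
  let ?A = "{x. X x \<le> (1 - \<epsilon>) * \<mu>}"
  have "pmf p x \<le> (1 - \<epsilon>) * pmf q x" if "x \<in> ?A" for x
  proof -
    have "pmf p x * \<mu> \<le> (1 - \<epsilon>) * \<mu> * pmf q x"
      unfolding bias using that by (intro mult_right_mono) auto
    then have "pmf p x * \<mu> \<le> (1 - \<epsilon>) * pmf q x * \<mu>" by (simp add: algebra_simps)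
    then show ?thesis using \<open>\<mu> > 0\<close> by simp
  qed
  then have "measure_pmf.prob p ?A
      \<le> (\<integral>x. (1 - \<epsilon>) * (pmf q x * indicator ?A x) \<partial>count_space UNIV)"
    unfolding prob_count_space[of p]
    by (intro integral_mono integrable_pmf_indicator integrable_mult_right)
       (auto simp: indicator_def)
  also have "\<dots> = (1 - \<epsilon>) * measure_pmf.prob q ?A"
    by (simp add: prob_count_space[of q])
  finally show ?thesis using prob_coupling_le[OF C, of ?A] by (simp add: algebra_simps)
qed

text \<open>
  The excess of \<open>q\<close> over \<open>p\<close> at \<open>x\<close> is \<open>q x\<close> times the positive part of \<open>1 - X x / \<mu>\<close>, which is at most \<open>\<epsilon>\<close>
  off the lower tail event and at most \<open>1\<close> on it. The hypothesis on \<open>C\<close> does not mention \<open>\<epsilon>\<close>, so that a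
  single coupling serves all \<open>\<epsilon>\<close>.
\<close>

lemma maximal_coupling_size_biased_le:
  fixes p q :: "'a pmf" and X :: "'a \<Rightarrow> real"
  assumes bias: "\<And>x. pmf p x * \<mu> = X x * pmf q x" and "\<mu> > 0"
    and C: "1 - measure_pmf.prob C {(x, y). x = y} \<le> (\<integral>x. max 0 (pmf q x - pmf p x) \<partial>count_space UNIV)"
    and "\<epsilon> \<ge> 0"
  shows "1 - measure_pmf.prob C {(x, y). x = y} \<le> \<epsilon> + measure_pmf.prob q {x. X x \<le> (1 - \<epsilon>) * \<mu>}"
proof -
  let ?A = "{x. X x \<le> (1 - \<epsilon>) * \<mu>}"
  have "max 0 (pmf q x - pmf p x) \<le> \<epsilon> * pmf q x + pmf q x * indicator ?A x" for x
  proof (cases "x \<in> ?A")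
    case True
    have "0 \<le> \<epsilon> * pmf q x" "0 \<le> pmf q x" "0 \<le> pmf p x" using \<open>\<epsilon> \<ge> 0\<close> by auto
    then have "max 0 (pmf q x - pmf p x) \<le> \<epsilon> * pmf q x + pmf q x" by linarith
    then show ?thesis using True by simp
  next
    case False
    then have "(1 - \<epsilon>) * \<mu> * pmf q x \<le> pmf p x * \<mu>"
      unfolding bias by (intro mult_right_mono) auto
    then have "((1 - \<epsilon>) * pmf q x) * \<mu> \<le> pmf p x * \<mu>" by (simp add: algebra_simps)
    then have "(1 - \<epsilon>) * pmf q x \<le> pmf p x" using \<open>\<mu> > 0\<close> by simp
    then show ?thesis using False \<open>\<epsilon> \<ge> 0\<close> by (simp add: algebra_simps)
  qed
  then have "(\<integral>x. max 0 (pmf q x - pmf p x) \<partial>count_space UNIV)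
      \<le> (\<integral>x. \<epsilon> * pmf q x + pmf q x * indicator ?A x \<partial>count_space UNIV)"
    by (intro integral_mono integrable_pmf_excess Bochner_Integration.integrable_add
              integrable_pmf_indicator integrable_mult_right integrable_pmf)
  also have "\<dots> = \<epsilon> + measure_pmf.prob q ?A"
    by (subst Bochner_Integration.integral_add)
       (auto simp: integral_pmf_count_space prob_count_space[of q] intro!: integrable_pmf_indicator
         integrable_mult_right integrable_pmf)
  finally show ?thesis using C by linarith
qed

section \<open>Edge-disjoint regular graphs\<close>

text \<open>
  Edges are coloured through a function of their two end points, symmetric in all uses. If every
  vertex meets exactly \<open>k\<close> edges of each colour, then any finite set of colours gives a regular graph, and
  disjoint sets of colours give edge-disjoint graphs.
\<close>

definition colour_class_union :: "nat \<Rightarrow> (nat \<Rightarrow> nat \<Rightarrow> 'c) \<Rightarrow> 'c set \<Rightarrow> graph" where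
  "colour_class_union n c S = {{v, w} |v w. v \<in> {1..n} \<and> w \<in> {1..n} \<and> v \<noteq> w \<and> c v w \<in> S}"

lemma colour_class_union_regular:
  assumes sym: "\<And>v w. c v w = c w v" and "finite S"
    and k: "\<And>v s. v \<in> {1..n} \<Longrightarrow> s \<in> S \<Longrightarrow> card {w \<in> {1..n}. w \<noteq> v \<and> c v w = s} = k"
  shows "colour_class_union n c S \<in> regular_graphs n (k * card S)"
proof -
  have "degree (colour_class_union n c S) v = k * card S" if v: "v \<in> {1..n}" for v
  proof -
    have "{e \<in> colour_class_union n c S. v \<in> e} = (\<lambda>w. {v, w}) ` (\<Union>s\<in>S. {w \<in> {1..n}. w \<noteq> v \<and> c v w = s})"
      using v sym by (fastforce simp: colour_class_union_def doubleton_eq_iff)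
    moreover have "inj_on (\<lambda>w. {v, w}) B" for B by (auto simp: inj_on_def doubleton_eq_iff)
    ultimately have "degree (colour_class_union n c S) v = card (\<Union>s\<in>S. {w \<in> {1..n}. w \<noteq> v \<and> c v w = s})"
      unfolding degree_def by (simp add: card_image)
    also have "\<dots> = (\<Sum>s\<in>S. card {w \<in> {1..n}. w \<noteq> v \<and> c v w = s})"
      using \<open>finite S\<close> by (intro card_UN_disjoint) auto
    also have "\<dots> = k * card S" using k[OF v] by simp
    finally show ?thesis .
  qed
  moreover have "colour_class_union n c S \<subseteq> nsets {1..n} 2"
    by (auto simp: colour_class_union_def nsets_def)
  ultimately show ?thesis by (simp add: regular_graphs_def)
qed

lemma colour_class_union_disjoint:
  assumes sym: "\<And>v w. c v w = c w v" and "S \<inter> T = {}"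
  shows "colour_class_union n c S \<inter> colour_class_union n c T = {}"
  using assms by (fastforce simp: colour_class_union_def doubleton_eq_iff)

lemma ex1_residue:
  fixes m :: nat and x :: int
  assumes "m > 0"
  shows "\<exists>!w. w \<in> {1..m} \<and> [int w = x] (mod int m)"
proof (rule ex_ex1I)
  let ?w = "nat ((x - 1) mod int m + 1)"
  have "0 \<le> (x - 1) mod int m" "(x - 1) mod int m < int m" using assms by auto
  then have "?w \<in> {1..m}" "int ?w = (x - 1) mod int m + 1" by auto
  moreover have "[(x - 1) mod int m + 1 = x] (mod int m)"
    by (simp add: cong_def mod_simps)
  ultimately show "\<exists>w. w \<in> {1..m} \<and> [int w = x] (mod int m)" by metis
next
  fix w w' assume w: "w \<in> {1..m} \<and> [int w = x] (mod int m)" "w' \<in> {1..m} \<and> [int w' = x] (mod int m)"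
  then have "[int w = int w'] (mod int m)" by (meson cong_sym cong_trans)
  then have "int m dvd int w - int w'" by (simp add: cong_iff_dvd_diff)
  moreover have "\<bar>int w - int w'\<bar> < int m" using w by auto
  ultimately have "int w - int w' = 0"
    using dvd_imp_le_int[of "int w - int w'" "int m"] by (metis abs_of_nat not_less)
  then show "w = w'" by simp
qed

lemma card_eq_1_of_ex1: "\<exists>!w. w \<in> A \<and> P w \<Longrightarrow> card {w \<in> A. P w} = 1"
  by (metis (mono_tags, lifting) is_singletonI' is_singleton_altdef mem_Collect_eq ex_in_conv Collect_empty_eq)

text \<open>
  The round-robin tournament schedule on \<open>{1..m + 1}\<close>: the edge between \<open>v\<close> and \<open>w\<close> in \<open>{1..m}\<close> is
  played in round \<open>v + w\<close> modulo \<open>m\<close>, and \<open>v\<close> meets the extra player \<open>m + 1\<close> in round \<open>2 * v\<close>, the only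
  one in which no opponent in \<open>{1..m}\<close> is left for \<open>v\<close>.
\<close>

definition round_robin_colour :: "nat \<Rightarrow> nat \<Rightarrow> nat \<Rightarrow> nat" where
  "round_robin_colour m v w =
     (if w = Suc m then (v + v) mod m else if v = Suc m then (w + w) mod m else (v + w) mod m)"

lemma round_robin_colour_sym: "round_robin_colour m v w = round_robin_colour m w v"
  by (auto simp: round_robin_colour_def add.commute)

lemma mod_eq_iff_cong_int: "s < m \<Longrightarrow> a mod m = s \<longleftrightarrow> [int a = int s] (mod int m)"
  unfolding cong_int_iff by (auto simp: cong_def)

text \<open>
  For the extra player the opponent in round \<open>s\<close> solves \<open>2 * w = s\<close> modulo \<open>m\<close>, which has a unique
  solution because \<open>m\<close> is odd. For \<open>v \<le> m\<close> it is the solution \<open>u\<close> of \<open>v + u = s\<close>, unless \<open>u = v\<close>, when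
  \<open>v\<close> meets the extra player.
\<close>

lemma card_round_robin_colour:
  assumes "odd m" and s: "s < m" and v: "v \<in> {1..Suc m}"
  shows "card {w \<in> {1..Suc m}. w \<noteq> v \<and> round_robin_colour m v w = s} = 1"
proof (cases "v = Suc m")
  case True
  \<comment> \<open>\<open>h\<close> is the inverse of \<open>2\<close> modulo \<open>m\<close>.\<close>
  obtain j where "m = 2 * j + 1" using \<open>odd m\<close> by (elim oddE)
  then obtain h where h: "2 * h = int m + 1" by (intro that[of "int j + 1"]) simp
  have "round_robin_colour m v w = s \<longleftrightarrow> [int w = h * int s] (mod int m)" if "w \<in> {1..m}" for w
  proof -
    have "round_robin_colour m v w = s \<longleftrightarrow> [2 * int w = int s] (mod int m)"
      using that True mod_eq_iff_cong_int[OF s, of "w + w"] by (simp add: round_robin_colour_def)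
    also have "\<dots> \<longleftrightarrow> [int w = h * int s] (mod int m)"
    proof
      assume "[2 * int w = int s] (mod int m)"
      then have "[h * (2 * int w) = h * int s] (mod int m)" by (rule cong_scalar_left)
      moreover have "h * (2 * int w) = int w + int m * int w"
        using h by (metis add.commute distrib_right mult.assoc mult.commute mult_1)
      ultimately show "[int w = h * int s] (mod int m)" by (simp add: cong_def)
    next
      assume "[int w = h * int s] (mod int m)"
      then have "[2 * int w = 2 * (h * int s)] (mod int m)" by (rule cong_scalar_left)
      moreover have "2 * (h * int s) = int s + int m * int s"
        using h by (metis add.commute distrib_right mult.assoc mult_1)
      ultimately show "[2 * int w = int s] (mod int m)" by (simp add: cong_def)
    qed
    finally show ?thesis .
  qed
  then have "{w \<in> {1..Suc m}. w \<noteq> v \<and> round_robin_colour m v w = s}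
      = {w \<in> {1..m}. [int w = h * int s] (mod int m)}"
    using True by (auto simp: le_Suc_eq)
  then show ?thesis using card_eq_1_of_ex1[OF ex1_residue] s by simp
next
  case False
  with v have vm: "v \<in> {1..m}" by auto
  obtain u where u: "u \<in> {1..m}" "[int u = int s - int v] (mod int m)"
    and uniq: "\<And>w. w \<in> {1..m} \<Longrightarrow> [int w = int s - int v] (mod int m) \<Longrightarrow> w = u"
    using ex1_residue[of m "int s - int v"] s by auto
  have sol: "(v + w) mod m = s \<longleftrightarrow> w = u" if "w \<in> {1..m}" for w
  proof -
    have "(v + w) mod m = s \<longleftrightarrow> [int w = int s - int v] (mod int m)"
      using mod_eq_iff_cong_int[OF s, of "v + w"] by (simp add: cong_iff_dvd_diff algebra_simps)
    then show ?thesis using u uniq that by blast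
  qed
  have "{w \<in> {1..Suc m}. w \<noteq> v \<and> round_robin_colour m v w = s} = {if u = v then Suc m else u}"
  proof (intro set_eqI)
    fix w
    consider "w = Suc m" | "w \<in> {1..m}" | "w \<notin> {1..Suc m}" by force
    then show "w \<in> {w \<in> {1..Suc m}. w \<noteq> v \<and> round_robin_colour m v w = s}
        \<longleftrightarrow> w \<in> {if u = v then Suc m else u}"
    proof cases
      case 1
      then show ?thesis using sol[OF vm] vm u(1) by (auto simp: round_robin_colour_def)
    next
      case 2
      then show ?thesis using sol[OF 2] vm u(1) by (auto simp: round_robin_colour_def)
    next
      case 3
      then show ?thesis using u(1) by auto
    qed
  qed
  then show ?thesis by simp
qed

definition cyclic_distance :: "nat \<Rightarrow> nat \<Rightarrow> nat \<Rightarrow> int" where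
  "cyclic_distance n v w = min ((int v - int w) mod int n) ((int w - int v) mod int n)"

text \<open>
  The vertices at distance \<open>s\<close> from \<open>v\<close> are the residues of \<open>v + s\<close> and \<open>v - s\<close>; the bound \<open>2 * s < n\<close>
  keeps these apart, since it excludes antipodal vertices.
\<close>

lemma card_cyclic_distance:
  assumes v: "v \<in> {1..n}" and s: "0 < s" "2 * s < int n"
  shows "card {w \<in> {1..n}. w \<noteq> v \<and> cyclic_distance n v w = s} = 2"
proof -
  have n: "n > 0" using v by simp
  obtain a where a: "a \<in> {1..n}" "[int a = int v + s] (mod int n)"
    and ua: "\<And>w. w \<in> {1..n} \<Longrightarrow> [int w = int v + s] (mod int n) \<Longrightarrow> w = a"
    using ex1_residue[OF n, of "int v + s"] by auto
  obtain b where b: "b \<in> {1..n}" "[int b = int v - s] (mod int n)"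
    and ub: "\<And>w. w \<in> {1..n} \<Longrightarrow> [int w = int v - s] (mod int n) \<Longrightarrow> w = b"
    using ex1_residue[OF n, of "int v - s"] by auto
  have small: "\<not> int n dvd x" if "0 < x" "x < int n" for x
    using that zdvd_not_zless by blast
  have "a \<noteq> b"
  proof
    assume "a = b"
    then have "[int v + s = int v - s] (mod int n)" using a b by (meson cong_sym cong_trans)
    then show False using small[of "2 * s"] s by (simp add: cong_iff_dvd_diff)
  qed
  have res: "x mod int n = s \<longleftrightarrow> [x = s] (mod int n)" for x
    using s by (auto simp: cong_def)
  have neg: "(- x) mod int n = int n - x mod int n" if "x mod int n \<noteq> 0" for x
    using that by (simp add: zmod_zminus1_eq_if)
  have dist: "cyclic_distance n v w = s \<longleftrightarrow>
      [int w = int v + s] (mod int n) \<or> [int w = int v - s] (mod int n)" for w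
  proof -
    let ?x = "int w - int v"
    have "cyclic_distance n v w = s \<longleftrightarrow> ?x mod int n = s \<or> (- ?x) mod int n = s"
    proof (cases "?x mod int n = 0")
      case True
      then have "(- ?x) mod int n = 0" unfolding zmod_zminus1_eq_if by simp
      with True show ?thesis using s by (simp add: cyclic_distance_def)
    next
      case False
      then show ?thesis using neg[OF False] s by (auto simp: cyclic_distance_def min_def)
    qed
    also have "\<dots> \<longleftrightarrow> [?x = s] (mod int n) \<or> [- ?x = s] (mod int n)" by (simp only: res)
    also have "[?x = s] (mod int n) \<longleftrightarrow> [int w = int v + s] (mod int n)"
      by (simp add: cong_iff_dvd_diff algebra_simps)
    also have "[- ?x = s] (mod int n) \<longleftrightarrow> [int w = int v - s] (mod int n)"
      unfolding cong_iff_dvd_diff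
      by (subst dvd_minus_iff[symmetric]) (simp add: algebra_simps)
    finally show ?thesis .
  qed
  have "cyclic_distance n v v = 0" by (simp add: cyclic_distance_def)
  then have "v \<noteq> w" if "cyclic_distance n v w = s" for w using that s(1) by (metis less_irrefl)
  then have "{w \<in> {1..n}. w \<noteq> v \<and> cyclic_distance n v w = s}
      = {w \<in> {1..n}. cyclic_distance n v w = s}"
    by blast
  also have "\<dots> = {a, b}"
  proof (intro set_eqI iffI)
    fix w assume "w \<in> {w \<in> {1..n}. cyclic_distance n v w = s}"
    then show "w \<in> {a, b}" using ua[of w] ub[of w] unfolding mem_Collect_eq dist by blast
  next
    fix w assume "w \<in> {a, b}"
    then show "w \<in> {w \<in> {1..n}. cyclic_distance n v w = s}"
      using a b unfolding mem_Collect_eq dist by blast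
  qed
  finally have "{w \<in> {1..n}. w \<noteq> v \<and> cyclic_distance n v w = s} = {a, b}" .
  then show ?thesis using \<open>a \<noteq> b\<close> by simp
qed

lemma exists_disjoint_regular_graphs:
  assumes "n \<ge> 1" "even (n * d1)" "even (n * d2)" "d1 + d2 \<le> n - 1"
  shows "\<exists>G\<in>regular_graphs n d1. \<exists>H\<in>regular_graphs n d2. G \<inter> H = {}"
proof (cases "even n")
  case True
  obtain m where n: "n = Suc m" using assms(1) by (cases n) auto
  with True have "odd m" by simp
  note m = n this
  let ?G = "colour_class_union n (round_robin_colour m)"
  have reg: "?G S \<in> regular_graphs n (card S)" if "S \<subseteq> {..<m}" for S
  proof -
    have "?G S \<in> regular_graphs n (1 * card S)"
    proof (rule colour_class_union_regular[OF round_robin_colour_sym])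
      show "finite S" using that finite_subset by blast
      fix v s assume "v \<in> {1..n}" "s \<in> S"
      then show "card {w \<in> {1..n}. w \<noteq> v \<and> round_robin_colour m v w = s} = 1"
        using that unfolding m(1) by (intro card_round_robin_colour[OF m(2)]) auto
    qed
    then show ?thesis by simp
  qed
  have "{..<d1} \<subseteq> {..<m}" "{d1..<d1+d2} \<subseteq> {..<m}" using assms(4) m(1) by auto
  from this[THEN reg] have "?G {..<d1} \<in> regular_graphs n d1" "?G {d1..<d1+d2} \<in> regular_graphs n d2"
    by simp_all
  moreover have "?G {..<d1} \<inter> ?G {d1..<d1+d2} = {}"
    by (rule colour_class_union_disjoint) (auto simp: round_robin_colour_sym)
  ultimately show ?thesis by blast
next
  case False
  with assms have "even d1" "even d2" by simp_all
  then obtain a b where ab: "d1 = 2 * a" "d2 = 2 * b" by (elim evenE)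
  let ?G = "colour_class_union n (cyclic_distance n)"
  have sym: "cyclic_distance n v w = cyclic_distance n w v" for v w
    by (simp add: cyclic_distance_def min.commute)
  have le: "2 * (a + b) < n" using assms(1,4) unfolding ab by arith
  have reg: "?G S \<in> regular_graphs n (2 * card S)" if "S \<subseteq> {0<..int (a + b)}" for S
  proof (rule colour_class_union_regular[OF sym])
    show "finite S" using that finite_subset by blast
    fix v s assume "v \<in> {1..n}" "s \<in> S"
    then show "card {w \<in> {1..n}. w \<noteq> v \<and> cyclic_distance n v w = s} = 2"
      using that le by (intro card_cyclic_distance) auto
  qed
  have "?G {0<..int a} \<in> regular_graphs n d1" "?G {int a<..int (a + b)} \<in> regular_graphs n d2"
    using reg[of "{0<..int a}"] reg[of "{int a<..int (a + b)}"] by (simp_all add: ab subset_iff)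
  moreover have "?G {0<..int a} \<inter> ?G {int a<..int (a + b)} = {}"
    by (rule colour_class_union_disjoint) (auto simp: sym)
  ultimately show ?thesis by blast
qed

section \<open>The edge-disjoint union as a size-biased random regular graph\<close>

lemma finite_regular_graphs: "finite (regular_graphs n d)"
  by (rule finite_subset[of _ "Pow (nsets {1..n} 2)"])
     (auto simp: regular_graphs_def finite_imp_finite_nsets)

lemma finite_of_regular_graph: "G \<in> regular_graphs n d \<Longrightarrow> finite G"
  by (auto simp: regular_graphs_def intro: finite_subset finite_imp_finite_nsets)

lemma degree_Un:
  assumes "finite G" "finite H" "G \<inter> H = {}"
  shows "degree (G \<union> H) v = degree G v + degree H v"
proof -
  have split: "{e \<in> G \<union> H. v \<in> e} = {e \<in> G. v \<in> e} \<union> {e \<in> H. v \<in> e}" by auto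
  show ?thesis unfolding degree_def split using assms by (intro card_Un_disjoint) auto
qed

lemma regular_graphs_Un:
  assumes "G \<in> regular_graphs n d1" "H \<in> regular_graphs n d2" "G \<inter> H = {}"
  shows "G \<union> H \<in> regular_graphs n (d1 + d2)"
  using assms degree_Un[of G H] finite_of_regular_graph
  by (auto simp: regular_graphs_def)

lemma regular_graphs_Diff:
  assumes "G \<in> regular_graphs n (d1 + d2)" "H \<in> regular_graphs n d1" "H \<subseteq> G"
  shows "G - H \<in> regular_graphs n d2"
proof -
  have "degree G v = degree H v + degree (G - H) v" for v
    using degree_Un[of H "G - H" v] assms finite_of_regular_graph
    by (metis Diff_disjoint Un_Diff_cancel finite_Diff sup.absorb2)
  then show ?thesis using assms by (auto simp: regular_graphs_def)
qed

lemma cond_pmf_of_set: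
  assumes "finite A" "A \<inter> B \<noteq> {}"
  shows "cond_pmf (pmf_of_set A) B = pmf_of_set (A \<inter> B)"
proof (rule pmf_eqI)
  fix x
  have A: "A \<noteq> {}" using assms(2) by blast
  then have "set_pmf (pmf_of_set A) \<inter> B \<noteq> {}" using assms by simp
  then have "pmf (cond_pmf (pmf_of_set A) B) x
      = (if x \<in> B then pmf (pmf_of_set A) x / measure_pmf.prob (pmf_of_set A) B else 0)"
    by (rule pmf_cond)
  then show "pmf (cond_pmf (pmf_of_set A) B) x = pmf (pmf_of_set (A \<inter> B)) x"
    using assms A by (simp add: measure_pmf_of_set indicator_def)
qed

definition disjoint_regular_pairs :: "nat \<Rightarrow> nat \<Rightarrow> nat \<Rightarrow> (graph \<times> graph) set" where
  "disjoint_regular_pairs n d1 d2 =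
     (regular_graphs n d1 \<times> regular_graphs n d2) \<inter> {(G, H). G \<inter> H = {}}"

text \<open>
  A decomposition is determined by its first part \<open>H\<close>; the second part has to be \<open>G - H\<close>.
\<close>

lemma card_pairs_with_union:
  assumes "G \<in> regular_graphs n (d1 + d2)"
  shows "card {(H, K) \<in> disjoint_regular_pairs n d1 d2. H \<union> K = G}
       = card (spanning_regular_subgraphs n d1 G)"
proof (rule bij_betw_same_card[of fst], rule bij_betw_byWitness[where f' = "\<lambda>H. (H, G - H)"])
  show "(\<lambda>H. (H, G - H)) ` spanning_regular_subgraphs n d1 G
      \<subseteq> {(H, K) \<in> disjoint_regular_pairs n d1 d2. H \<union> K = G}"
    using regular_graphs_Diff[OF assms]
    by (auto simp: spanning_regular_subgraphs_def disjoint_regular_pairs_def)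
qed (auto simp: spanning_regular_subgraphs_def disjoint_regular_pairs_def)

lemma finite_disjoint_regular_pairs: "finite (disjoint_regular_pairs n d1 d2)"
  by (simp add: disjoint_regular_pairs_def finite_regular_graphs)

lemma card_disjoint_regular_pairs:
  "card (disjoint_regular_pairs n d1 d2)
     = (\<Sum>G\<in>regular_graphs n (d1 + d2). card (spanning_regular_subgraphs n d1 G))"
proof -
  let ?P = "disjoint_regular_pairs n d1 d2"
  have "?P = (\<Union>G\<in>regular_graphs n (d1 + d2). {(H, K) \<in> ?P. H \<union> K = G})"
    using regular_graphs_Un by (fastforce simp: disjoint_regular_pairs_def)
  then have "card ?P = card (\<Union>G\<in>regular_graphs n (d1 + d2). {(H, K) \<in> ?P. H \<union> K = G})" by simp
  also have "\<dots> = (\<Sum>G\<in>regular_graphs n (d1 + d2). card {(H, K) \<in> ?P. H \<union> K = G})"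
    by (intro card_UN_disjoint finite_regular_graphs)
       (auto intro: finite_subset[OF _ finite_disjoint_regular_pairs])
  also have "\<dots> = (\<Sum>G\<in>regular_graphs n (d1 + d2). card (spanning_regular_subgraphs n d1 G))"
    by (intro sum.cong refl card_pairs_with_union)
  finally show ?thesis .
qed

text \<open>
  The union of a uniform pair equals \<open>G\<close> with probability \<open>X G\<close> divided by the number of pairs, and
  counting pairs by their union shows that this number is \<open>\<mu>\<close> times the number of \<open>d\<close>-regular graphs,
  where \<open>d = d1 + d2\<close>.
\<close>

lemma random_regular_sum_size_biased:
  assumes "disjoint_regular_pairs n d1 d2 \<noteq> {}"
  defines "X \<equiv> \<lambda>G. real (card (spanning_regular_subgraphs n d1 G))"
  defines "\<mu> \<equiv> measure_pmf.expectation (random_regular n (d1 + d2)) X"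
  shows "\<mu> > 0"
    and "pmf (random_regular_sum n d1 d2) G * \<mu> = X G * pmf (random_regular n (d1 + d2)) G"
proof -
  let ?P = "disjoint_regular_pairs n d1 d2" and ?R = "regular_graphs n (d1 + d2)"
  have ne: "regular_graphs n d1 \<noteq> {}" "regular_graphs n d2 \<noteq> {}"
    using assms(1) by (auto simp: disjoint_regular_pairs_def)
  have R: "?R \<noteq> {}" using assms(1) regular_graphs_Un by (fastforce simp: disjoint_regular_pairs_def)
  have "card ?R > 0" using R finite_regular_graphs by (simp add: card_gt_0_iff)
  have "card ?P > 0" using assms(1) finite_disjoint_regular_pairs by (simp add: card_gt_0_iff)
  have "\<mu> = (\<Sum>H\<in>?R. X H) / card ?R"
    unfolding \<mu>_def random_regular_def by (rule integral_pmf_of_set[OF R finite_regular_graphs])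
  then have \<mu>: "\<mu> = card ?P / card ?R"
    by (simp add: card_disjoint_regular_pairs X_def)
  show "\<mu> > 0" unfolding \<mu> using \<open>card ?R > 0\<close> \<open>card ?P > 0\<close> by simp
  have "pair_pmf (random_regular n d1) (random_regular n d2)
      = pmf_of_set (regular_graphs n d1 \<times> regular_graphs n d2)"
    unfolding random_regular_def
  proof (rule pmf_eqI)
    fix z
    show "pmf (pair_pmf (pmf_of_set (regular_graphs n d1)) (pmf_of_set (regular_graphs n d2))) z
        = pmf (pmf_of_set (regular_graphs n d1 \<times> regular_graphs n d2)) z"
      using ne by (cases z) (simp add: pmf_pair finite_regular_graphs card_cartesian_product indicator_def)
  qed
  then have "random_regular_sum n d1 d2 = map_pmf (\<lambda>(G, H). G \<union> H) (pmf_of_set ?P)"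
    using assms(1) cond_pmf_of_set[of "regular_graphs n d1 \<times> regular_graphs n d2"]
    unfolding random_regular_sum_def disjoint_regular_pairs_def
    by (simp add: finite_regular_graphs)
  then have "pmf (random_regular_sum n d1 d2) G
      = card (?P \<inter> (\<lambda>(G, H). G \<union> H) -` {G}) / card ?P"
    by (simp add: pmf_map measure_pmf_of_set[OF assms(1) finite_disjoint_regular_pairs])
  also have "?P \<inter> (\<lambda>(G, H). G \<union> H) -` {G} = {(H, K) \<in> ?P. H \<union> K = G}" by auto
  finally have p: "pmf (random_regular_sum n d1 d2) G = card {(H, K) \<in> ?P. H \<union> K = G} / card ?P" .
  have q: "pmf (random_regular n (d1 + d2)) G = indicator ?R G / card ?R"
    unfolding random_regular_def by (rule pmf_of_set[OF R finite_regular_graphs])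
  show "pmf (random_regular_sum n d1 d2) G * \<mu> = X G * pmf (random_regular n (d1 + d2)) G"
  proof (cases "G \<in> ?R")
    case True
    then show ?thesis using \<open>card ?P > 0\<close>
      unfolding p q \<mu> X_def card_pairs_with_union[OF True] by simp
  next
    case False
    then have "{(H, K) \<in> ?P. H \<union> K = G} = {}"
      using regular_graphs_Un by (fastforce simp: disjoint_regular_pairs_def)
    then have "pmf (random_regular_sum n d1 d2) G = 0" unfolding p by (simp only: card.empty)
    then show ?thesis using False unfolding q by simp
  qed
qed

section \<open>Coupling and concentration of the number of regular spanning subgraphs\<close>

theorem lemma1p5:
  fixes d1 d2 :: "nat \<Rightarrow> nat"
  assumes "\<And>n. n \<in> admissible d1 d2 \<Longrightarrow> d1 n + d2 n \<le> n - 1"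
    and "filterlim (\<lambda>n. d1 n + d2 n) at_top (admissible_at_top d1 d2)"
  shows "(\<exists>C :: nat \<Rightarrow> (graph \<times> graph) pmf.
            (\<forall>n \<in> admissible d1 d2.
               is_coupling (C n) (random_regular_sum n (d1 n) (d2 n))
                 (random_regular n (d1 n + d2 n))) \<and>
            ((\<lambda>n. measure_pmf.prob (C n) {(G, G'). G = G'}) \<longlongrightarrow> 1) (admissible_at_top d1 d2))
     \<longleftrightarrow>
         (\<forall>\<epsilon>::real. \<epsilon> > 0 \<longrightarrow>
            ((\<lambda>n. measure_pmf.prob (random_regular n (d1 n + d2 n))
                {G. real (card (spanning_regular_subgraphs n (d1 n) G)) \<le>
                    (1 - \<epsilon>) * measure_pmf.expectation (random_regular n (d1 n + d2 n))
                      (\<lambda>H. real (card (spanning_regular_subgraphs n (d1 n) H)))})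
              \<longlongrightarrow> 0) (admissible_at_top d1 d2))"
proof -
  let ?F = "admissible_at_top d1 d2"
  define p where "p n = random_regular_sum n (d1 n) (d2 n)" for n
  define q where "q n = random_regular n (d1 n + d2 n)" for n
  define X where "X n = (\<lambda>G. real (card (spanning_regular_subgraphs n (d1 n) G)))" for n
  define \<mu> where "\<mu> n = measure_pmf.expectation (q n) (X n)" for n
  define tail where "tail \<epsilon> n = measure_pmf.prob (q n) {G. X n G \<le> (1 - \<epsilon>) * \<mu> n}" for \<epsilon> n
  define differ where "differ C n = 1 - measure_pmf.prob (C n) {(G, G'). G = G'}"
    for C :: "nat \<Rightarrow> (graph \<times> graph) pmf" and n
  have ev: "eventually (\<lambda>n. n \<in> admissible d1 d2) ?F"
    by (simp add: admissible_at_top_def eventually_inf_principal)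
  have bias: "\<mu> n > 0" "pmf (p n) G * \<mu> n = X n G * pmf (q n) G" if "n \<in> admissible d1 d2" for n G
  proof -
    have "disjoint_regular_pairs n (d1 n) (d2 n) \<noteq> {}"
      using exists_disjoint_regular_graphs[of n "d1 n" "d2 n"] that assms(1)[OF that]
      by (auto simp: admissible_def disjoint_regular_pairs_def)
    from random_regular_sum_size_biased[OF this]
    show "\<mu> n > 0" "pmf (p n) G * \<mu> n = X n G * pmf (q n) G"
      by (simp_all add: p_def q_def X_def \<mu>_def)
  qed
  have differ_lim: "(differ C \<longlongrightarrow> 0) ?F
      \<longleftrightarrow> ((\<lambda>n. measure_pmf.prob (C n) {(G, G'). G = G'}) \<longlongrightarrow> 1) ?F" for C
    using Lim_null[of "\<lambda>n. measure_pmf.prob (C n) {(G, G'). G = G'}" 1 ?F]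
      tendsto_minus_cancel_left[of "differ C" 0 ?F]
    by (simp add: differ_def[abs_def])
  have "(\<exists>C. (\<forall>n\<in>admissible d1 d2. is_coupling (C n) (p n) (q n)) \<and> (differ C \<longlongrightarrow> 0) ?F)
      \<longleftrightarrow> (\<forall>\<epsilon>>0. (tail \<epsilon> \<longlongrightarrow> 0) ?F)"
  proof safe
    fix C and \<epsilon> :: real
    assume C: "\<forall>n\<in>admissible d1 d2. is_coupling (C n) (p n) (q n)"
      and lim: "(differ C \<longlongrightarrow> 0) ?F" and "\<epsilon> > 0"
    have le: "eventually (\<lambda>n. tail \<epsilon> n \<le> differ C n / \<epsilon>) ?F"
      using ev
    proof eventually_elim
      case (elim n)
      have "\<epsilon> * tail \<epsilon> n \<le> differ C n"
        unfolding tail_def differ_def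
        using elim C by (intro size_biased_lower_tail_le[where p = "p n"] bias) auto
      then show ?case using \<open>\<epsilon> > 0\<close> by (simp add: field_simps)
    qed
    have lim': "((\<lambda>n. differ C n / \<epsilon>) \<longlongrightarrow> 0) ?F"
      using tendsto_divide[OF lim tendsto_const[of \<epsilon>]] \<open>\<epsilon> > 0\<close> by simp
    have "eventually (\<lambda>n. 0 \<le> tail \<epsilon> n) ?F" by (simp add: tail_def)
    from tendsto_sandwich[OF this le tendsto_const lim'] show "(tail \<epsilon> \<longlongrightarrow> 0) ?F" .
  next
    assume tail: "\<forall>\<epsilon>>0. (tail \<epsilon> \<longlongrightarrow> 0) ?F"
    let ?excess = "\<lambda>n. \<integral>x. max 0 (pmf (q n) x - pmf (p n) x) \<partial>count_space UNIV"
    have "\<forall>n. \<exists>C. is_coupling C (p n) (q n) \<and> 1 - measure_pmf.prob C {(x, y). x = y}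
        \<le> ?excess n"
      using exists_maximal_coupling by blast
    from choice[OF this] obtain C where "\<forall>n. is_coupling (C n) (p n) (q n) \<and>
        1 - measure_pmf.prob (C n) {(x, y). x = y} \<le> ?excess n" by (elim exE)
    then have C: "is_coupling (C n) (p n) (q n)"
      "1 - measure_pmf.prob (C n) {(x, y). x = y} \<le> ?excess n" for n by simp_all
    have "(differ C \<longlongrightarrow> 0) ?F"
    proof (rule order_tendstoI)
      fix a :: real assume "a < 0"
      moreover have "0 \<le> differ C n" for n by (simp add: differ_def)
      ultimately have "a < differ C n" for n by (rule less_le_trans)
      then show "eventually (\<lambda>n. a < differ C n) ?F" by simp
    next
      fix a :: real assume "0 < a"
      then have "(tail (a / 2) \<longlongrightarrow> 0) ?F" using tail by simp
      from order_tendstoD(2)[OF this, of "a / 2"] \<open>0 < a\<close>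
      have "eventually (\<lambda>n. tail (a / 2) n < a / 2) ?F" by simp
      with ev show "eventually (\<lambda>n. differ C n < a) ?F"
      proof eventually_elim
        case (elim n)
        have "differ C n \<le> a / 2 + tail (a / 2) n"
          unfolding tail_def differ_def
          using elim C \<open>0 < a\<close> by (intro maximal_coupling_size_biased_le[where p = "p n"] bias) auto
        then show ?case using elim by simp
      qed
    qed
    with C(1) show "\<exists>C. (\<forall>n\<in>admissible d1 d2. is_coupling (C n) (p n) (q n)) \<and> (differ C \<longlongrightarrow> 0) ?F"
      by blast
  qed
  then show ?thesis
    unfolding differ_lim p_def q_def X_def \<mu>_def tail_def[abs_def] .
qed

end
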